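(* Let $I$ be an index set, $a^1,\dots,a^n,b\in\mathbb{R}^I$ and $c\in\mathbb{R}^n$. For $y\in\mathbb{R}^I$ put $$OV(y)=\inf\Big\{\sum_{k=1}^n c_kx_k : x\in\mathbb{R}^n,\ \sum_{k=1}^n a^k(i)x_k\ge y(i)\ \text{ for all } i\in I\Big\}.$$ Suppose the program with right-hand side $b$ is feasible and bounded. Let $U=\mathrm{span}(a^1,\dots,a^n,b)$ and let $\psi^*$ be the unique optimal solution of $\mathrm{DSILP}(U)$. Then $\psi^*$ satisfies the dual pricing equation for every perturbation $d\in U$: for every $d\in U$ there exists $\hat\epsilon>0$ such that $$OV(b+\epsilon d)=\psi^*(b+\epsilon d)=OV(b)+\epsilon\,\psi^*(d)\qquad\text{for all }\epsilon\in[0,\hat\epsilon].$$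
   Context: Feasible and bounded means the feasible set is nonempty and the optimal value is $>-\infty$. $\mathrm{DSILP}(U)$ is the problem: maximize $\psi(b)$ over real linear functionals $\psi$ on $U$ that are positive (i.e. $\psi(y)\ge0$ for every $y\in U$ with $y(i)\ge0$ for all $i\in I$) and satisfy $\psi(a^k)=c_k$ for $k=1,\dots,n$. When the primal is feasible and bounded, $\mathrm{DSILP}(U)$ has a unique optimal solution $\psi^*$, called the base dual solution; it is the linear functional on $U$ with $\psi^*(a^k)=c_k$ for all $k$ and $\psi^*(b)=OV(b)$. *)

theory Defs
  imports "HOL-Analysis.Analysis" "HOL-Library.Function_Algebras" "HOL-Library.FuncSet"
begin

instantiation "fun" :: (type, real_vector) real_vector
begin

definition scaleR_fun :: "real \<Rightarrow> ('a \<Rightarrow> 'b) \<Rightarrow> 'a \<Rightarrow> 'b"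
  where "scaleR_fun r f = (\<lambda>i. r *\<^sub>R f i)"

instance
  by standard (auto simp: scaleR_fun_def fun_eq_iff scaleR_add_right scaleR_add_left)

end

text \<open>
  The index set \<open>I\<close> is an arbitrary, possibly empty, subset of a type; \<open>\<real>\<^sup>I\<close> is represented
  by the linear subspace of all functions that vanish off \<open>I\<close>.
\<close>

definition fun_space :: "'i set \<Rightarrow> ('i \<Rightarrow> real) set"
  where "fun_space I = {y. \<forall>i. i \<notin> I \<longrightarrow> y i = 0}"

definition primal_feasible :: "'i set \<Rightarrow> ('n::finite \<Rightarrow> 'i \<Rightarrow> real) \<Rightarrow> ('i \<Rightarrow> real) \<Rightarrow> (real ^ 'n) set"
  where "primal_feasible I a y = {x. \<forall>i\<in>I. (\<Sum>k\<in>UNIV. a k i * x $ k) \<ge> y i}"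

text \<open>
  The optimal value is an extended real: it is \<open>\<infinity>\<close> for an infeasible program and \<open>-\<infinity>\<close> for an
  unbounded one.
\<close>

definition OV :: "'i set \<Rightarrow> ('n::finite \<Rightarrow> 'i \<Rightarrow> real) \<Rightarrow> real ^ 'n \<Rightarrow> ('i \<Rightarrow> real) \<Rightarrow> ereal"
  where "OV I a c y = (INF x\<in>primal_feasible I a y. ereal (\<Sum>k\<in>UNIV. c $ k * x $ k))"

definition feasible_and_bounded ::
    "'i set \<Rightarrow> ('n::finite \<Rightarrow> 'i \<Rightarrow> real) \<Rightarrow> real ^ 'n \<Rightarrow> ('i \<Rightarrow> real) \<Rightarrow> bool"
  where "feasible_and_bounded I a c y \<longleftrightarrow> primal_feasible I a y \<noteq> {} \<and> OV I a c y > -\<infinity>"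

text \<open>
  A functional with domain \<open>U\<close> is an extensional function (equal to \<open>undefined\<close> off \<open>U\<close>), so that
  two functionals are equal iff they agree on \<open>U\<close>.
\<close>

definition linear_functional_on :: "('i \<Rightarrow> real) set \<Rightarrow> (('i \<Rightarrow> real) \<Rightarrow> real) \<Rightarrow> bool"
  where "linear_functional_on U \<psi> \<longleftrightarrow> \<psi> \<in> extensional U \<and>
    (\<forall>y\<in>U. \<forall>z\<in>U. \<psi> (y + z) = \<psi> y + \<psi> z) \<and> (\<forall>r. \<forall>y\<in>U. \<psi> (r *\<^sub>R y) = r * \<psi> y)"

definition positive_on :: "'i set \<Rightarrow> ('i \<Rightarrow> real) set \<Rightarrow> (('i \<Rightarrow> real) \<Rightarrow> real) \<Rightarrow> bool"
  where "positive_on I U \<psi> \<longleftrightarrow> (\<forall>y\<in>U. (\<forall>i\<in>I. y i \<ge> 0) \<longrightarrow> \<psi> y \<ge> 0)"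

definition DSILP_feasible ::
    "'i set \<Rightarrow> ('n::finite \<Rightarrow> 'i \<Rightarrow> real) \<Rightarrow> real ^ 'n \<Rightarrow> ('i \<Rightarrow> real) set \<Rightarrow> (('i \<Rightarrow> real) \<Rightarrow> real) \<Rightarrow> bool"
  where "DSILP_feasible I a c U \<psi> \<longleftrightarrow>
    linear_functional_on U \<psi> \<and> positive_on I U \<psi> \<and> (\<forall>k. \<psi> (a k) = c $ k)"

definition DSILP_optimal ::
    "'i set \<Rightarrow> ('n::finite \<Rightarrow> 'i \<Rightarrow> real) \<Rightarrow> ('i \<Rightarrow> real) \<Rightarrow> real ^ 'n \<Rightarrow> ('i \<Rightarrow> real) set \<Rightarrow>
      (('i \<Rightarrow> real) \<Rightarrow> real) \<Rightarrow> bool"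
  where "DSILP_optimal I a b c U \<psi> \<longleftrightarrow> is_arg_max (\<lambda>\<phi>. \<phi> b) (DSILP_feasible I a c U) \<psi>"

end

theory Submission
  imports Defs
begin

text \<open>
  Write a point of \<open>U = span (insert b (range a))\<close> as \<open>y = A z + t b\<close>, where \<open>A z\<close> is the
  combination of the functions \<open>a k\<close> with coefficients \<open>z\<close>.  For \<open>t > 0\<close> the substitution
  \<open>x \<mapsto> t x + z\<close> carries the feasible set of the program with right-hand side \<open>b\<close> onto that of the
  program with right-hand side \<open>y\<close>, and so \<open>OV (A z + t b) = c \<bullet> z + t OV b\<close>: the optimal value is
  given by a linear formula wherever the coefficient of \<open>b\<close> is positive (lemma \<open>OV_half_space\<close>).
  At \<open>b\<close> itself the coefficient is \<open>1\<close>, and for \<open>b + \<epsilon> d\<close> with \<open>d \<in> U\<close> it stays positive as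
  long as \<open>\<epsilon>\<close> is small, which is the pricing equation once the
  optimal dual solution is known to satisfy \<open>\<psi> (A z + t b) = c \<bullet> z + t OV b\<close>.

  Weak duality bounds \<open>\<psi> b\<close> by \<open>OV b\<close> for every dual feasible \<open>\<psi>\<close>, and a dual feasible \<open>\<psi>\<close> is
  determined on \<open>U\<close> by \<open>\<psi> b\<close>.  It remains to see that the bound is attained, that is, that the
  formula above defines a positive functional.  The inequality behind this is
  \<open>A z + t b \<ge> 0 \<Longrightarrow> c \<bullet> z + t OV b \<ge> 0\<close> (lemma \<open>value_nonneg\<close>); applied to the
  difference of two representations of the same function, it also shows that the formula does not
  depend on the representation.
\<close>

section \<open>Coordinates on the span of the columns and the right-hand side\<close>

definition column_comb ::
    "('n::finite \<Rightarrow> 'i \<Rightarrow> real) \<Rightarrow> ('i \<Rightarrow> real) \<Rightarrow> real ^ 'n \<Rightarrow> real \<Rightarrow> 'i \<Rightarrow> real"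
  where "column_comb a b x t = (\<lambda>i. (\<chi> k. a k i) \<bullet> x + t * b i)"

lemma column_comb_add:
  "column_comb a b x s + column_comb a b y t = column_comb a b (x + y) (s + t)"
  by (auto simp: column_comb_def fun_eq_iff algebra_simps inner_add_right)

lemma column_comb_scaleR:
  "r *\<^sub>R column_comb a b x t = column_comb a b (r *\<^sub>R x) (r * t)"
  by (auto simp: column_comb_def scaleR_fun_def fun_eq_iff algebra_simps)

lemma column_comb_axis: "column_comb a b (axis k 1) 0 = a k"
  by (auto simp: column_comb_def fun_eq_iff inner_axis)

lemma column_comb_rhs: "column_comb a b 0 1 = b"
  by (auto simp: column_comb_def fun_eq_iff)

lemma column_comb_eq_sum:
  "column_comb a b x t = (\<Sum>k\<in>UNIV. x $ k *\<^sub>R a k) + t *\<^sub>R b"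
proof
  fix i
  have "(\<Sum>k\<in>K. x $ k *\<^sub>R a k) i = (\<Sum>k\<in>K. x $ k * a k i)" if "finite K" for K
    using that by induction (auto simp: scaleR_fun_def)
  then show "column_comb a b x t i = ((\<Sum>k\<in>UNIV. x $ k *\<^sub>R a k) + t *\<^sub>R b) i"
    by (simp add: column_comb_def inner_vec_def scaleR_fun_def mult.commute)
qed

lemma span_eq_column_combs:
  "span (insert b (range a)) = {column_comb a b x t | x t. True}" (is "_ = ?C")
proof
  have "0 \<in> ?C"
    using column_comb_eq_sum[of a b 0 0] by auto
  then have "subspace ?C"
    unfolding subspace_def by (fastforce simp: column_comb_add column_comb_scaleR)
  moreover have "insert b (range a) \<subseteq> ?C"
    by (auto intro: column_comb_axis[symmetric] column_comb_rhs[symmetric])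
  ultimately show "span (insert b (range a)) \<subseteq> ?C"
    by (rule span_minimal[rotated])
  show "?C \<subseteq> span (insert b (range a))"
    unfolding column_comb_eq_sum
    by (auto simp del: image_eqI intro!: span_add span_sum span_scale intro: span_base)
qed

text \<open>
  The constraints \<open>\<phi> (a k) = c $ k\<close> leave \<open>\<phi> b\<close> as the only free value of a dual solution on the
  span.
\<close>

lemma linear_functional_column_comb:
  assumes lin: "linear_functional_on (span (insert b (range a))) \<phi>"
    and val: "\<And>k. \<phi> (a k) = c $ k"
  shows "\<phi> (column_comb a b x t) = c \<bullet> x + t * \<phi> b"
proof -
  let ?U = "span (insert b (range a))"
  have add: "\<phi> (y + z) = \<phi> y + \<phi> z" if "y \<in> ?U" "z \<in> ?U" for y z
    using lin that by (auto simp: linear_functional_on_def)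
  have scale: "\<phi> (r *\<^sub>R y) = r * \<phi> y" if "y \<in> ?U" for r y
    using lin that by (auto simp: linear_functional_on_def)
  have zero: "\<phi> 0 = 0"
    using scale[OF span_zero, of 0] by simp
  have aU: "a k \<in> ?U" and bU: "b \<in> ?U" for k
    by (auto intro: span_base)
  have sumU: "(\<Sum>k\<in>K. x $ k *\<^sub>R a k) \<in> ?U" for K
    by (intro span_sum span_scale aU)
  have "\<phi> (\<Sum>k\<in>K. x $ k *\<^sub>R a k) = (\<Sum>k\<in>K. x $ k * c $ k)" if "finite K" for K
    using that
  proof induction
    case (insert k K)
    have "\<phi> (\<Sum>k\<in>insert k K. x $ k *\<^sub>R a k) = \<phi> (x $ k *\<^sub>R a k + (\<Sum>k\<in>K. x $ k *\<^sub>R a k))"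
      by (simp only: sum.insert[OF insert.hyps])
    also have "\<dots> = x $ k * \<phi> (a k) + \<phi> (\<Sum>k\<in>K. x $ k *\<^sub>R a k)"
      by (simp only: add[OF span_scale[OF aU] sumU] scale[OF aU])
    also have "\<dots> = (\<Sum>k\<in>insert k K. x $ k * c $ k)"
      by (simp only: val insert.IH sum.insert[OF insert.hyps])
    finally show ?case .
  qed (simp only: sum.empty zero)
  then show ?thesis
    by (simp add: column_comb_eq_sum add scale sumU bU span_scale inner_vec_def mult.commute)
qed

section \<open>The optimal value function\<close>

lemma primal_feasible_iff:
  "x \<in> primal_feasible I a y \<longleftrightarrow> (\<forall>i\<in>I. y i \<le> (\<chi> k. a k i) \<bullet> x)"
  by (simp add: primal_feasible_def inner_vec_def)

lemma OV_eq_INF_inner: "OV I a c y = (INF x\<in>primal_feasible I a y. ereal (c \<bullet> x))"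
  by (simp add: OV_def inner_vec_def)

lemma OV_le: "x \<in> primal_feasible I a y \<Longrightarrow> OV I a c y \<le> ereal (c \<bullet> x)"
  unfolding OV_eq_INF_inner by (rule INF_lower)

lemma OV_greatest:
  "(\<And>x. x \<in> primal_feasible I a y \<Longrightarrow> r \<le> ereal (c \<bullet> x)) \<Longrightarrow> r \<le> OV I a c y"
  unfolding OV_eq_INF_inner by (rule INF_greatest)

lemma finite_OV:
  assumes "feasible_and_bounded I a c y"
  obtains v where "OV I a c y = ereal v"
proof -
  obtain x where "x \<in> primal_feasible I a y" and "OV I a c y > - \<infinity>"
    using assms by (auto simp: feasible_and_bounded_def)
  then show thesis
    using that OV_le[of x I a y c] by (cases "OV I a c y") auto
qed

text \<open>
  Passing from \<open>b\<close> to \<open>A z + t b\<close> with \<open>t > 0\<close> is the change of variables \<open>x \<mapsto> t x + z\<close>, which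
  turns the objective \<open>c \<bullet> x\<close> into \<open>t (c \<bullet> x) + c \<bullet> z\<close>.
\<close>

lemma OV_half_space:
  assumes v: "OV I a c b = ereal v" and t: "t > 0"
  shows "OV I a c (column_comb a b z t) = ereal (c \<bullet> z + t * v)"
proof (rule antisym)
  show "ereal (c \<bullet> z + t * v) \<le> OV I a c (column_comb a b z t)"
  proof (rule OV_greatest)
    fix x assume x: "x \<in> primal_feasible I a (column_comb a b z t)"
    have "(1 / t) *\<^sub>R (x - z) \<in> primal_feasible I a b"
      using x t by (auto simp: primal_feasible_iff column_comb_def inner_diff_right field_simps)
    from OV_le[OF this, of c] show "ereal (c \<bullet> z + t * v) \<le> ereal (c \<bullet> x)"
      using t by (simp add: v inner_diff_right field_simps)
  qed
  have move: "OV I a c (column_comb a b z t) \<le> ereal (c \<bullet> z + t * (c \<bullet> x))"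
    if x: "x \<in> primal_feasible I a b" for x
  proof -
    have "t *\<^sub>R x + z \<in> primal_feasible I a (column_comb a b z t)"
      using x t by (auto simp: primal_feasible_iff column_comb_def inner_add_right)
    from OV_le[OF this, of c] show ?thesis
      by (simp add: inner_add_right add.commute)
  qed
  show "OV I a c (column_comb a b z t) \<le> ereal (c \<bullet> z + t * v)"
  proof (rule ereal_le_epsilon2)
    fix e :: real assume e: "0 < e"
    have "OV I a c b < ereal (v + e / t)"
      using e t by (simp add: v)
    then obtain x where "x \<in> primal_feasible I a b" and "c \<bullet> x < v + e / t"
      unfolding OV_eq_INF_inner by (auto simp: INF_less_iff)
    moreover from this have "c \<bullet> z + t * (c \<bullet> x) \<le> c \<bullet> z + t * v + e"
      using t by (simp add: field_simps)
    ultimately show "OV I a c (column_comb a b z t) \<le> ereal (c \<bullet> z + t * v) + ereal e"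
      using move[of x] by (metis ereal_less_eq(3) order_trans plus_ereal.simps(1))
  qed
qed

text \<open>
  A direction \<open>z\<close> with \<open>A z \<ge> 0\<close> and \<open>c \<bullet> z < 0\<close> could be followed indefinitely from any feasible
  point, driving the objective to \<open>-\<infinity>\<close>.
\<close>

lemma recession_direction_nonneg:
  assumes fb: "feasible_and_bounded I a c b"
    and z: "z \<in> primal_feasible I a 0"
  shows "c \<bullet> z \<ge> 0"
proof (rule ccontr)
  assume "\<not> c \<bullet> z \<ge> 0"
  then have neg: "c \<bullet> z < 0" by simp
  obtain v where v: "OV I a c b = ereal v"
    using fb by (rule finite_OV)
  obtain x where x: "x \<in> primal_feasible I a b"
    using fb by (auto simp: feasible_and_bounded_def)
  have "v \<le> c \<bullet> x + s * (c \<bullet> z)" if "s \<ge> 0" for s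
  proof -
    have "x + s *\<^sub>R z \<in> primal_feasible I a b"
      using x z that by (auto simp: primal_feasible_iff inner_add_right intro: add_increasing2)
    from OV_le[OF this, of c] show ?thesis
      by (simp add: v inner_add_right)
  qed
  \<comment> \<open>This step length brings the objective down to \<open>v - 1\<close>.\<close>
  from this[of "(v - 1 - c \<bullet> x) / (c \<bullet> z)"] this[of 0] show False
    using neg by (simp add: divide_nonpos_neg)
qed

text \<open>
  The sign of \<open>t\<close> decides the reason.  If \<open>t < 0\<close>, then \<open>z / (- t)\<close> is feasible for \<open>b\<close>, so its
  objective is at least \<open>v\<close>.  If \<open>t \<ge> 0\<close>, then \<open>t x + z\<close> is a recession direction for every \<open>x\<close>
  feasible for \<open>b\<close>, so \<open>t (c \<bullet> x) + c \<bullet> z \<ge> 0\<close>; the infimum over \<open>x\<close> gives the claim.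
\<close>

lemma value_nonneg:
  assumes fb: "feasible_and_bounded I a c b"
    and v: "OV I a c b = ereal v"
    and nonneg: "\<forall>i\<in>I. column_comb a b z t i \<ge> 0"
  shows "c \<bullet> z + t * v \<ge> 0"
proof -
  have recession: "c \<bullet> z + t * (c \<bullet> x) \<ge> 0" if "t \<ge> 0" and x: "x \<in> primal_feasible I a b" for x
  proof -
    have "t *\<^sub>R x + z \<in> primal_feasible I a 0"
      unfolding primal_feasible_iff
    proof
      fix i assume "i \<in> I"
      then have "0 \<le> (\<chi> k. a k i) \<bullet> z + t * b i" and "t * b i \<le> t * ((\<chi> k. a k i) \<bullet> x)"
        using nonneg x \<open>t \<ge> 0\<close>
        by (auto simp: column_comb_def primal_feasible_iff intro: mult_left_mono)
      then show "0 i \<le> (\<chi> k. a k i) \<bullet> (t *\<^sub>R x + z)"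
        by (simp add: inner_add_right)
    qed
    from recession_direction_nonneg[OF fb this] show ?thesis
      by (simp add: inner_add_right add.commute)
  qed
  consider "t < 0" | "t = 0" | "t > 0" by linarith
  then show ?thesis
  proof cases
    case 1
    have "(1 / (- t)) *\<^sub>R z \<in> primal_feasible I a b"
      using nonneg 1 by (auto simp: primal_feasible_iff column_comb_def field_simps)
    from OV_le[OF this, of c] show ?thesis
      using 1 by (simp add: v field_simps)
  next
    case 2
    with recession fb show ?thesis
      by (auto simp: feasible_and_bounded_def)
  next
    case 3
    have "ereal (- (c \<bullet> z) / t) \<le> OV I a c b"
    proof (rule OV_greatest)
      fix x assume "x \<in> primal_feasible I a b"
      with recession[of x] 3 show "ereal (- (c \<bullet> z) / t) \<le> ereal (c \<bullet> x)"
        by (simp add: field_simps)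
    qed
    with 3 show ?thesis by (simp add: v field_simps)
  qed
qed

section \<open>The base dual solution and its pricing equation\<close>

text \<open>
  The functional sends \<open>A z + t b\<close> to \<open>c \<bullet> z + t v\<close>.  Where two representations of one function
  are compared, both the difference and its negative are nonnegative on \<open>I\<close>, so their values agree
  by \<open>value_nonneg\<close>.
\<close>

lemma base_dual_solution_exists:
  assumes fb: "feasible_and_bounded I a c b" and v: "OV I a c b = ereal v"
  obtains \<psi> where "DSILP_feasible I a c (span (insert b (range a))) \<psi>" "\<psi> b = v"
proof -
  define U where "U = span (insert b (range a))"
  have value_le: "c \<bullet> z + t * v \<le> c \<bullet> z' + t' * v"
    if eq: "column_comb a b z t = column_comb a b z' t'" for z t z' t'
  proof -
    have "column_comb a b (z' - z) (t' - t) i = 0" for i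
      using fun_cong[OF eq, of i] by (simp add: column_comb_def inner_diff_right algebra_simps)
    with value_nonneg[OF fb v, of "z' - z" "t' - t"] show ?thesis
      by (simp add: inner_diff_right algebra_simps)
  qed
  have value_eq: "c \<bullet> z + t * v = c \<bullet> z' + t' * v"
    if "column_comb a b z t = column_comb a b z' t'" for z t z' t'
    using value_le[OF that] value_le[OF that[symmetric]] by (rule antisym)
  define \<psi> where "\<psi> = restrict (\<lambda>y. THE r. \<exists>z t. y = column_comb a b z t \<and> r = c \<bullet> z + t * v) U"
  have combU: "column_comb a b z t \<in> U" for z t
    by (auto simp: U_def span_eq_column_combs)
  have \<psi>: "\<psi> (column_comb a b z t) = c \<bullet> z + t * v" for z t
  proof -
    have "(THE r. \<exists>z' t'. column_comb a b z t = column_comb a b z' t' \<and> r = c \<bullet> z' + t' * v)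
        = c \<bullet> z + t * v"
      by (rule the_equality) (auto intro: value_eq[symmetric])
    then show ?thesis by (simp add: \<psi>_def combU)
  qed
  have U_cases: "\<exists>z t. y = column_comb a b z t" if "y \<in> U" for y
    using that by (auto simp: U_def span_eq_column_combs)
  have "linear_functional_on U \<psi>"
    unfolding linear_functional_on_def
  proof (intro conjI ballI allI)
    show "\<psi> \<in> extensional U" by (simp add: \<psi>_def)
  next
    fix y y' assume "y \<in> U" "y' \<in> U"
    then show "\<psi> (y + y') = \<psi> y + \<psi> y'"
      by (auto dest!: U_cases simp: column_comb_add \<psi> inner_add_right algebra_simps)
  next
    fix r y assume "y \<in> U"
    then show "\<psi> (r *\<^sub>R y) = r * \<psi> y"
      by (auto dest!: U_cases simp: column_comb_scaleR \<psi> algebra_simps)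
  qed
  moreover have "positive_on I U \<psi>"
    unfolding positive_on_def
    by (auto dest!: U_cases simp: \<psi> intro: value_nonneg[OF fb v])
  moreover have "\<psi> (a k) = c $ k" for k
    using \<psi>[of "axis k 1" 0] by (simp add: column_comb_axis inner_axis)
  ultimately have "DSILP_feasible I a c U \<psi>"
    by (simp add: DSILP_feasible_def)
  moreover have "\<psi> b = v"
    using \<psi>[of 0 1] by (simp add: column_comb_rhs)
  ultimately show thesis
    using that by (simp add: U_def)
qed

text \<open>
  Weak duality: if \<open>x\<close> is feasible, then \<open>A x - b\<close> is nonnegative on \<open>I\<close>, and a dual feasible
  \<open>\<phi>\<close> sends it to \<open>c \<bullet> x - \<phi> b\<close>.
\<close>

lemma dual_value_le_OV:
  assumes \<phi>: "DSILP_feasible I a c (span (insert b (range a))) \<phi>"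
  shows "ereal (\<phi> b) \<le> OV I a c b"
proof (rule OV_greatest)
  fix x assume "x \<in> primal_feasible I a b"
  then have "\<forall>i\<in>I. column_comb a b x (- 1) i \<ge> 0"
    by (simp add: primal_feasible_iff column_comb_def)
  moreover have "column_comb a b x (- 1) \<in> span (insert b (range a))"
    by (auto simp: span_eq_column_combs)
  ultimately have "0 \<le> \<phi> (column_comb a b x (- 1))"
    using \<phi> by (auto simp: DSILP_feasible_def positive_on_def)
  also have "\<dots> = c \<bullet> x - \<phi> b"
    using \<phi> by (subst linear_functional_column_comb) (auto simp: DSILP_feasible_def)
  finally show "ereal (\<phi> b) \<le> ereal (c \<bullet> x)" by simp
qed

text \<open>
  The base dual solution attains the bound of weak duality, so every maximizer has to attain it too.
\<close>

lemma DSILP_optimal_iff: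
  assumes fb: "feasible_and_bounded I a c b" and v: "OV I a c b = ereal v"
  shows "DSILP_optimal I a b c (span (insert b (range a))) \<psi> \<longleftrightarrow>
    DSILP_feasible I a c (span (insert b (range a))) \<psi> \<and> \<psi> b = v"
proof -
  let ?F = "DSILP_feasible I a c (span (insert b (range a)))"
  obtain \<psi>0 where \<psi>0: "?F \<psi>0" "\<psi>0 b = v"
    using base_dual_solution_exists[OF fb v] .
  have le: "\<phi> b \<le> v" if "?F \<phi>" for \<phi>
    using dual_value_le_OV[OF that] by (simp add: v)
  show ?thesis
    unfolding DSILP_optimal_def is_arg_max_def
  proof
    assume opt: "?F \<psi> \<and> (\<nexists>\<phi>. ?F \<phi> \<and> \<psi> b < \<phi> b)"
    then have "\<not> \<psi> b < v"
      using \<psi>0 by blast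
    with opt le[of \<psi>] show "?F \<psi> \<and> \<psi> b = v"
      by simp
  next
    assume "?F \<psi> \<and> \<psi> b = v"
    then show "?F \<psi> \<and> (\<nexists>\<phi>. ?F \<phi> \<and> \<psi> b < \<phi> b)"
      using le by (auto simp: not_less)
  qed
qed

lemma DSILP_feasible_eqI:
  assumes \<phi>: "DSILP_feasible I a c (span (insert b (range a))) \<phi>"
    and \<psi>: "DSILP_feasible I a c (span (insert b (range a))) \<psi>"
    and eq: "\<phi> b = \<psi> b"
  shows "\<phi> = \<psi>"
proof (rule extensionalityI)
  show "\<phi> \<in> extensional (span (insert b (range a)))" "\<psi> \<in> extensional (span (insert b (range a)))"
    using \<phi> \<psi> by (simp_all add: DSILP_feasible_def linear_functional_on_def)
  fix y assume "y \<in> span (insert b (range a))"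
  then obtain z t where y: "y = column_comb a b z t"
    by (auto simp: span_eq_column_combs)
  show "\<phi> y = \<psi> y"
    using \<phi> \<psi> eq linear_functional_column_comb[of b a \<phi> c z t]
      linear_functional_column_comb[of b a \<psi> c z t]
    by (simp add: y DSILP_feasible_def)
qed

theorem theorem4p3:
  fixes I :: "'i set"
    and a :: "'n::finite \<Rightarrow> 'i \<Rightarrow> real"
    and b :: "'i \<Rightarrow> real"
    and c :: "real ^ 'n"
    and U :: "('i \<Rightarrow> real) set"
  assumes "\<And>k. a k \<in> fun_space I" and "b \<in> fun_space I"
    and "feasible_and_bounded I a c b"
    and "U = span (insert b (range a))"
  shows "(\<exists>!\<psi>. DSILP_optimal I a b c U \<psi>) \<and>
    (\<forall>\<psi>. DSILP_optimal I a b c U \<psi> \<longrightarrow>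
      (\<forall>d\<in>U. \<exists>\<epsilon>'>0. \<forall>\<epsilon>\<in>{0..\<epsilon>'}.
        OV I a c (b + \<epsilon> *\<^sub>R d) = ereal (\<psi> (b + \<epsilon> *\<^sub>R d)) \<and>
        ereal (\<psi> (b + \<epsilon> *\<^sub>R d)) = OV I a c b + ereal (\<epsilon> * \<psi> d)))"
proof -
  note fb = assms(3)
  obtain v where v: "OV I a c b = ereal v"
    using fb by (rule finite_OV)
  have opt_iff: "DSILP_optimal I a b c U \<psi> \<longleftrightarrow> DSILP_feasible I a c U \<psi> \<and> \<psi> b = v" for \<psi>
    unfolding assms(4) by (rule DSILP_optimal_iff[OF fb v])
  obtain \<psi>0 where "DSILP_feasible I a c U \<psi>0" "\<psi>0 b = v"
    unfolding assms(4) using base_dual_solution_exists[OF fb v] .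
  moreover have "\<phi> = \<psi>" if "DSILP_feasible I a c U \<phi>" "DSILP_feasible I a c U \<psi>" "\<phi> b = \<psi> b"
    for \<phi> \<psi>
    using DSILP_feasible_eqI[of I a c b \<phi> \<psi>] that by (simp add: assms(4))
  ultimately have "\<exists>!\<psi>. DSILP_optimal I a b c U \<psi>"
    unfolding opt_iff by (intro ex1I[of _ \<psi>0]) auto
  moreover have "\<exists>\<epsilon>'>0. \<forall>\<epsilon>\<in>{0..\<epsilon>'}.
        OV I a c (b + \<epsilon> *\<^sub>R d) = ereal (\<psi> (b + \<epsilon> *\<^sub>R d)) \<and>
        ereal (\<psi> (b + \<epsilon> *\<^sub>R d)) = OV I a c b + ereal (\<epsilon> * \<psi> d)"
    if opt: "DSILP_optimal I a b c U \<psi>" and "d \<in> U" for \<psi> d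
  proof -
    from \<open>d \<in> U\<close> obtain z t where d: "d = column_comb a b z t"
      by (auto simp: assms(4) span_eq_column_combs)
    have \<psi>: "\<psi> (column_comb a b x s) = c \<bullet> x + s * v" for x s
      using opt[unfolded opt_iff] linear_functional_column_comb[of b a \<psi> c x s]
      by (simp add: DSILP_feasible_def assms(4))
    have shift: "b + \<epsilon> *\<^sub>R d = column_comb a b (\<epsilon> *\<^sub>R z) (1 + \<epsilon> * t)" for \<epsilon>
      using column_comb_add[of a b 0 1 "\<epsilon> *\<^sub>R z" "\<epsilon> * t"]
      by (simp add: d column_comb_scaleR column_comb_rhs)
    \<comment> \<open>The bound \<open>1 / (1 + \<bar>t\<bar>)\<close> keeps the coefficient \<open>1 + \<epsilon> t\<close> of \<open>b\<close> positive.\<close>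
    have pos: "1 + \<epsilon> * t > 0" if "\<epsilon> \<in> {0..1 / (1 + \<bar>t\<bar>)}" for \<epsilon>
    proof -
      have "\<epsilon> * (1 + \<bar>t\<bar>) \<le> 1" and "0 \<le> \<epsilon>"
        using that by (auto simp: field_simps)
      moreover have "- (\<epsilon> * \<bar>t\<bar>) \<le> \<epsilon> * t"
        using \<open>0 \<le> \<epsilon>\<close> by (metis abs_ge_minus_self abs_mult abs_of_nonneg minus_le_iff)
      ultimately show ?thesis
        by (cases "\<epsilon> = 0") (auto simp: algebra_simps)
    qed
    show ?thesis
    proof (intro exI[of _ "1 / (1 + \<bar>t\<bar>)"] conjI ballI)
      show "0 < 1 / (1 + \<bar>t\<bar>)" by simp
    next
      fix \<epsilon> assume "\<epsilon> \<in> {0..1 / (1 + \<bar>t\<bar>)}"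
      then show "OV I a c (b + \<epsilon> *\<^sub>R d) = ereal (\<psi> (b + \<epsilon> *\<^sub>R d))"
        by (simp add: shift \<psi> OV_half_space[OF v pos])
      show "ereal (\<psi> (b + \<epsilon> *\<^sub>R d)) = OV I a c b + ereal (\<epsilon> * \<psi> d)"
        unfolding shift \<psi> v by (simp add: d \<psi> algebra_simps)
    qed
  qed
  ultimately show ?thesis by blast
qed

end
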